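(* Let $n$ be an even positive integer and $1\le k\le n-1$. For integers $m\ge1$ and $j$, let $\mathcal{P}_{m,j}$ denote the number of parity alternating permutations of $[m]$ with exactly $j$ ascents, and $\mathcal{N}_{m,j}$ the number of permutations of $[m]$ with exactly $j$ ascents that are not parity alternating. Then \[ \mathcal{P}_{n,k}=(n-k)\mathcal{P}_{n-1,k-1}+(k+1)\mathcal{P}_{n-1,k},\qquad \mathcal{N}_{n,k}=(n-k)\mathcal{N}_{n-1,k-1}+(k+1)\mathcal{N}_{n-1,k}. \]
   Context: A permutation $a_1a_2\cdots a_m$ of $[m]=\{1,\dots,m\}$ (one-line notation) is parity alternating if $a_i$ and $a_{i+1}$ have different parities for every $1\le i\le m-1$. An ascent is an index $i$ ($1\le i\le m-1$) with $a_i<a_{i+1}$. A permutation of $[m]$ has at most $m-1$ ascents, so counts with $j\ge m$ ascents are $0$. *)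

theory Defs
  imports Main "HOL-Combinatorics.Multiset_Permutations"
begin

text \<open>
  A permutation of \<open>[m]\<close> is represented by its one-line notation, that is, by an element of
  \<^term>\<open>permutations_of_set {1..m}\<close>. The letter \<open>a\<^sub>i\<close> is \<open>xs ! (i - 1)\<close>, so all positions
  below are shifted down by one.
\<close>

definition parity_alternating :: "nat list \<Rightarrow> bool" where
  "parity_alternating xs \<longleftrightarrow> (\<forall>i. Suc i < length xs \<longrightarrow> even (xs ! i) \<noteq> even (xs ! Suc i))"

definition ascents :: "nat list \<Rightarrow> nat set" where
  "ascents xs = {i. Suc i < length xs \<and> xs ! i < xs ! Suc i}"

definition pap_count :: "nat \<Rightarrow> nat \<Rightarrow> nat" where
  "pap_count m j =
     card {xs \<in> permutations_of_set {1..m}. parity_alternating xs \<and> card (ascents xs) = j}"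

definition non_pap_count :: "nat \<Rightarrow> nat \<Rightarrow> nat" where
  "non_pap_count m j =
     card {xs \<in> permutations_of_set {1..m}. \<not> parity_alternating xs \<and> card (ascents xs) = j}"

end

theory Submission
  imports Defs
begin

text \<open>
  Every permutation of \<open>[n]\<close> is a rotation of \<open>n # b\<close> for a unique permutation \<open>b\<close> of \<open>[n - 1]\<close> and
  a unique rotation amount below \<open>n\<close>. Read cyclically, \<open>n # b\<close> has one ascent more than \<open>b\<close>, and
  cutting the cycle at an ascent destroys exactly that ascent. Hence \<open>b\<close> has \<open>k + 1\<close> rotations with
  \<open>k\<close> ascents if it has \<open>k\<close> ascents itself, it has \<open>n - k\<close> of them if it has \<open>k - 1\<close> ascents, and
  none otherwise. For even \<open>n\<close> rotation preserves parity alternation, and \<open>n # b\<close> is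
  parity alternating exactly when \<open>b\<close> is, so the count splits into the two cases of the theorem.
\<close>

section \<open>Cyclic ascents\<close>

text \<open>The reduction modulo the length compares the last letter with the first, so the set has
  a size that rotation cannot change.\<close>

definition cyclic_ascents :: "nat list \<Rightarrow> nat set" where
  "cyclic_ascents xs = {i. i < length xs \<and> xs ! i < xs ! (Suc i mod length xs)}"

lemma finite_ascents [simp]: "finite (ascents xs)"
  by (rule finite_subset[of _ "{..<length xs}"]) (auto simp: ascents_def)

lemma bij_betw_add_mod:
  fixes n r :: nat
  shows "bij_betw (\<lambda>i. (r + i) mod n) {..<n} {..<n}"
proof -
  have "inj_on (\<lambda>i. (r + i) mod n) {..<n}"
  proof (rule inj_onI)
    fix i j
    assume ij: "i \<in> {..<n}" "j \<in> {..<n}" and eq: "(r + i) mod n = (r + j) mod n"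
    have "i mod n = j mod n"
      using eq by (simp add: nat_mod_eq_iff add.assoc)
    then show "i = j" using ij by simp
  qed
  moreover have "(\<lambda>i. (r + i) mod n) ` {..<n} \<subseteq> {..<n}"
    by (auto intro!: mod_less_divisor)
  ultimately show ?thesis
    by (simp add: bij_betw_def endo_inj_surj)
qed

text \<open>Translation by \<open>r\<close> permutes the residues modulo \<open>n\<close>. This
  gives the rotation invariance of the cyclic ascent number and also matches cutting points with
  cyclic ascents.\<close>

lemma card_shift_mod:
  fixes n r :: nat
  shows "card {i. i < n \<and> P ((r + i) mod n)} = card {i. i < n \<and> P i}"
proof (rule bij_betw_same_card, rule bij_betw_subset[OF bij_betw_add_mod])
  have "(\<lambda>i. (r + i) mod n) ` {i. i < n \<and> P ((r + i) mod n)} =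
      {i \<in> (\<lambda>i. (r + i) mod n) ` {..<n}. P i}"
    by auto
  then show "(\<lambda>i. (r + i) mod n) ` {i. i < n \<and> P ((r + i) mod n)} = {i. i < n \<and> P i}"
    using bij_betw_add_mod[of r n] by (simp add: bij_betw_def)
qed auto

lemma nth_rotate_Suc_mod:
  assumes "i < length xs"
  shows "rotate r xs ! (Suc i mod length xs) = xs ! (Suc ((r + i) mod length xs) mod length xs)"
proof -
  have "Suc i mod length xs < length xs" using assms by (intro mod_less_divisor) auto
  then show ?thesis by (simp add: nth_rotate mod_simps)
qed

lemma card_cyclic_ascents_rotate:
  "card (cyclic_ascents (rotate r xs)) = card (cyclic_ascents xs)"
proof -
  have "cyclic_ascents (rotate r xs) = {i. i < length xs \<and>
      (\<lambda>j. xs ! j < xs ! (Suc j mod length xs)) ((r + i) mod length xs)}"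
    by (auto simp: cyclic_ascents_def nth_rotate nth_rotate_Suc_mod)
  then show ?thesis
    unfolding cyclic_ascents_def[of xs]
    by (simp only: card_shift_mod[where P = "\<lambda>j. xs ! j < xs ! (Suc j mod length xs)"])
qed

lemma card_cyclic_ascents:
  assumes "xs \<noteq> []"
  shows "card (cyclic_ascents xs) = card (ascents xs) + of_bool (last xs < hd xs)"
proof -
  define n where "n = length xs"
  have n: "n > 0" using assms by (simp add: n_def)
  have "cyclic_ascents xs = ascents xs \<union> (if last xs < hd xs then {n - 1} else {})"
  proof (intro set_eqI)
    fix i
    consider "Suc i < n" | "i = n - 1" | "i \<ge> n" using n by linarith
    then show "i \<in> cyclic_ascents xs \<longleftrightarrow>
        i \<in> ascents xs \<union> (if last xs < hd xs then {n - 1} else {})"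
      using n assms
      by cases (auto simp: cyclic_ascents_def ascents_def last_conv_nth hd_conv_nth
          simp flip: n_def)
  qed
  moreover have "n - 1 \<notin> ascents xs" using n by (auto simp: ascents_def n_def)
  ultimately show ?thesis by simp
qed

text \<open>Rotation by \<open>r\<close> cuts the cycle just before position \<open>r\<close>; last
  letter below first means that the cut falls on the cyclic ascent at \<open>r - 1\<close> modulo
  the length.\<close>

lemma card_rotate_last_less_hd:
  "card {r. r < length xs \<and> last (rotate r xs) < hd (rotate r xs)} = card (cyclic_ascents xs)"
proof (cases "xs = []")
  case False
  define n where "n = length xs"
  have n: "n > 0" using False by (simp add: n_def)
  \<comment> \<open>Adding \<open>n - 1\<close> is subtracting 1 modulo \<open>n\<close>, which
    stays correct at \<open>r = 0\<close>.\<close>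
  have "last (rotate r xs) < hd (rotate r xs) \<longleftrightarrow>
      xs ! ((n - 1 + r) mod n) < xs ! (Suc ((n - 1 + r) mod n) mod n)" if "r < n" for r
  proof -
    have "Suc ((n - 1 + r) mod n) mod n = r"
      using n that by (simp add: mod_simps)
    moreover have "hd (rotate r xs) = xs ! r"
      using False that by (simp add: hd_rotate_conv_nth n_def)
    moreover have "last (rotate r xs) = xs ! ((n - 1 + r) mod n)"
      using False n by (simp add: last_conv_nth nth_rotate n_def add.commute)
    ultimately show ?thesis by simp
  qed
  then have "{r. r < n \<and> last (rotate r xs) < hd (rotate r xs)} =
      {r. r < n \<and> (\<lambda>i. xs ! i < xs ! (Suc i mod n)) ((n - 1 + r) mod n)}"
    by auto
  then show ?thesis
    unfolding cyclic_ascents_def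
    using card_shift_mod[where P = "\<lambda>i. xs ! i < xs ! (Suc i mod n)" and r = "n - 1" and n = n]
    by (simp add: n_def)
qed (simp add: cyclic_ascents_def)

lemma ascents_Cons:
  "ascents (x # b) = (if b \<noteq> [] \<and> x < hd b then {0} else {}) \<union> Suc ` ascents b"
proof (intro set_eqI)
  fix i
  show "i \<in> ascents (x # b) \<longleftrightarrow>
      i \<in> (if b \<noteq> [] \<and> x < hd b then {0} else {}) \<union> Suc ` ascents b"
    by (cases i) (auto simp: ascents_def hd_conv_nth)
qed

text \<open>A leading maximum starts with a descent, while the step from the end of \<open>b\<close>
  back to it is an ascent.\<close>

lemma card_cyclic_ascents_Cons_max:
  assumes "b \<noteq> []" and "\<And>y. y \<in> set b \<Longrightarrow> y < x"
  shows "card (cyclic_ascents (x # b)) = Suc (card (ascents b))"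
proof -
  have "\<not> x < hd b" using assms by (meson hd_in_set less_asym)
  then have "card (ascents (x # b)) = card (ascents b)"
    by (simp add: ascents_Cons card_image)
  then show ?thesis using assms by (simp add: card_cyclic_ascents)
qed

text \<open>With \<open>a\<close> ascents in \<open>b\<close>, the cycle has \<open>a + 1\<close>.
  Cuts at these leave \<open>a\<close> ascents each, all other cuts leave \<open>a + 1\<close>. The
  bound \<open>k \<ge> 1\<close> keeps the cases \<open>a = k\<close> and \<open>a = k - 1\<close>
  apart.\<close>

lemma card_rotations_with_ascents:
  assumes b: "b \<noteq> []" and max: "\<And>y. y \<in> set b \<Longrightarrow> y < x" and k: "k \<ge> 1"
  shows "card {r. r < Suc (length b) \<and> card (ascents (rotate r (x # b))) = k} =
    (Suc (length b) - k) * of_bool (card (ascents b) = k - 1) +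
    (k + 1) * of_bool (card (ascents b) = k)"
proof -
  define n where "n = Suc (length b)"
  define a where "a = card (ascents b)"
  define A where "A = {r. r < n \<and> last (rotate r (x # b)) < hd (rotate r (x # b))}"
  have cyc: "card (cyclic_ascents (x # b)) = Suc a"
    unfolding a_def using b max by (rule card_cyclic_ascents_Cons_max)
  have A: "card A = Suc a" "A \<subseteq> {..<n}"
    using card_rotate_last_less_hd[of "x # b"] cyc by (auto simp: A_def n_def)
  have asc: "card (ascents (rotate r (x # b))) + of_bool (r \<in> A) = Suc a" if "r < n" for r
    using that card_cyclic_ascents[of "rotate r (x # b)"] cyc
    by (simp add: card_cyclic_ascents_rotate A_def)
  have S: "{r. r < n \<and> card (ascents (rotate r (x # b))) = k} =
      (if a = k then A else if a = k - 1 then {..<n} - A else {})"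
  proof (intro set_eqI)
    fix r
    have "r < n" if "r \<in> A" using A(2) that by blast
    moreover have "card (ascents (rotate r (x # b))) = k \<longleftrightarrow> Suc a = k + of_bool (r \<in> A)"
      if "r < n"
      using asc[OF that] by linarith
    ultimately show "r \<in> {r. r < n \<and> card (ascents (rotate r (x # b))) = k} \<longleftrightarrow>
        r \<in> (if a = k then A else if a = k - 1 then {..<n} - A else {})"
      using k by (cases "r \<in> A") auto
  qed
  have diff: "card ({..<n} - A) = n - Suc a"
    using A by (simp add: card_Diff_subset finite_subset)
  consider "a = k" | "Suc a = k" | "a \<noteq> k" "Suc a \<noteq> k" by blast
  then show ?thesis
    unfolding n_def[symmetric] a_def[symmetric] S
    by cases (use A(1) diff k in auto)
qed

section \<open>Permutations as rotations\<close>

text \<open>Rotating \<open>x\<close> to the front and deleting it recovers \<open>b\<close>, so the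
  map is onto; injectivity follows because both sides have \<open>(card A + 1)!\<close>
  elements.\<close>

lemma bij_betw_rotate_Cons_permutations:
  assumes "finite A" and "x \<notin> A"
  shows "bij_betw (\<lambda>(b, r). rotate r (x # b))
    (permutations_of_set A \<times> {..<Suc (card A)}) (permutations_of_set (insert x A))"
    (is "bij_betw ?f ?D ?E")
proof -
  define n where "n = Suc (card A)"
  have "?f ` ?D = ?E"
  proof
    show "?f ` ?D \<subseteq> ?E"
      using assms by (auto simp: permutations_of_set_def)
    show "?E \<subseteq> ?f ` ?D"
    proof
      fix xs assume xs: "xs \<in> ?E"
      then have len: "length xs = n" and "x \<in> set xs" "distinct xs" "set xs = insert x A"
        using assms by (auto simp: permutations_of_set_def n_def simp flip: distinct_card)
      then obtain j where j: "j < n" "xs ! j = x"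
        by (metis in_set_conv_nth)
      have "xs \<noteq> []" using \<open>x \<in> set xs\<close> by auto
      then have "hd (rotate j xs) = x" and "rotate j xs \<noteq> []"
        using j len by (auto simp: hd_rotate_conv_nth)
      then obtain b where b: "rotate j xs = x # b"
        by (metis list.collapse)
      have "set (x # b) = insert x A" "distinct (x # b)"
        using \<open>set xs = insert x A\<close> \<open>distinct xs\<close> by (simp_all flip: b)
      then have "b \<in> permutations_of_set A"
        using assms by (auto simp: permutations_of_set_def)
      \<comment> \<open>The reduction modulo \<open>n\<close> matters for \<open>j = 0\<close>,
        where \<open>n - j\<close> itself is not an admissible amount.\<close>
      moreover have "rotate ((n - j) mod n) (x # b) = xs"
      proof -
        have "rotate ((n - j) mod n) (x # b) = rotate (n - j) (rotate j xs)"
          using len rotate_conv_mod[of "n - j" "rotate j xs"] by (simp flip: b)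
        also have "\<dots> = xs"
          using j len by (simp add: rotate_rotate)
        finally show ?thesis .
      qed
      moreover have "(n - j) mod n < n" using j by simp
      ultimately show "xs \<in> ?f ` ?D"
        unfolding n_def by force
    qed
  qed
  moreover have "card ?D = card ?E"
    using assms by (simp add: card_cartesian_product)
  ultimately show ?thesis
    using assms by (simp add: bij_betw_def eq_card_imp_inj_on)
qed

text \<open>Keeping \<open>Q\<close> and \<open>Q'\<close> abstract lets one count serve both parity
  alternation and its negation.\<close>

lemma card_permutations_ascents_recurrence:
  assumes n: "n \<ge> 2" and k: "k \<ge> 1"
    and Q: "\<And>b r. b \<in> permutations_of_set {1..n - 1} \<Longrightarrow> Q' (rotate r (n # b)) \<longleftrightarrow> Q b"
  shows "card {xs \<in> permutations_of_set {1..n}. Q' xs \<and> card (ascents xs) = k} =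
    (n - k) * card {b \<in> permutations_of_set {1..n - 1}. Q b \<and> card (ascents b) = k - 1} +
    (k + 1) * card {b \<in> permutations_of_set {1..n - 1}. Q b \<and> card (ascents b) = k}"
proof -
  define S where "S = permutations_of_set {1..n - 1}"
  define R where "R b = {r. r < n \<and> card (ascents (rotate r (n # b))) = k}" for b
  have fin: "finite S" by (simp add: S_def)
  have bij: "bij_betw (\<lambda>(b, r). rotate r (n # b)) (S \<times> {..<n}) (permutations_of_set {1..n})"
  proof -
    have "insert n {1..n - 1} = {1..n}" "Suc (card {1..n - 1}) = n" using n by auto
    then show ?thesis
      using bij_betw_rotate_Cons_permutations[of "{1..n - 1}" n] n by (simp add: S_def)
  qed
  \<comment> \<open>The property \<open>Q'\<close> constrains only \<open>b\<close>; the ascent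
    condition then constrains \<open>r\<close> for each fixed \<open>b\<close>.\<close>
  have "bij_betw (\<lambda>(b, r). rotate r (n # b)) (Sigma {b \<in> S. Q b} R)
      {xs \<in> permutations_of_set {1..n}. Q' xs \<and> card (ascents xs) = k}"
  proof (rule bij_betw_subset[OF bij])
    show "Sigma {b \<in> S. Q b} R \<subseteq> S \<times> {..<n}" by (auto simp: R_def)
    have "(\<lambda>(b, r). rotate r (n # b)) ` Sigma {b \<in> S. Q b} R =
        {xs \<in> (\<lambda>(b, r). rotate r (n # b)) ` (S \<times> {..<n}). Q' xs \<and> card (ascents xs) = k}"
      using Q by (auto simp: R_def S_def)
    then show "(\<lambda>(b, r). rotate r (n # b)) ` Sigma {b \<in> S. Q b} R =
        {xs \<in> permutations_of_set {1..n}. Q' xs \<and> card (ascents xs) = k}"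
      using bij by (simp add: bij_betw_def)
  qed
  then have "card {xs \<in> permutations_of_set {1..n}. Q' xs \<and> card (ascents xs) = k} =
      card (Sigma {b \<in> S. Q b} R)"
    by (simp add: bij_betw_same_card)
  also have "\<dots> = (\<Sum>b\<in>{b \<in> S. Q b}. card (R b))"
    using fin by (simp add: card_SigmaI R_def)
  also have "\<dots> = (\<Sum>b\<in>{b \<in> S. Q b}. (n - k) * of_bool (card (ascents b) = k - 1) +
      (k + 1) * of_bool (card (ascents b) = k))"
  proof (rule sum.cong[OF refl])
    fix b assume "b \<in> {b \<in> S. Q b}"
    then have b: "set b = {1..n - 1}" "distinct b" by (auto simp: S_def permutations_of_set_def)
    then have "Suc (length b) = n" using n distinct_card[of b] by simp
    moreover have "b \<noteq> []" using b n by auto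
    moreover have "y < n" if "y \<in> set b" for y using that b n by auto
    ultimately show "card (R b) = (n - k) * of_bool (card (ascents b) = k - 1) +
        (k + 1) * of_bool (card (ascents b) = k)"
      unfolding R_def using card_rotations_with_ascents[of b n k] k by simp
  qed
  also have "\<dots> = (n - k) * card {b \<in> S. Q b \<and> card (ascents b) = k - 1} +
      (k + 1) * card {b \<in> S. Q b \<and> card (ascents b) = k}"
    using fin by (simp only: sum.distrib flip: sum_distrib_left)
      (simp add: sum.If_cases of_bool_def Int_def conj_assoc)
  finally show ?thesis by (simp add: S_def)
qed

section \<open>Parity alternation\<close>

lemma parity_alternating_Cons:
  "parity_alternating (x # b) \<longleftrightarrow>
    (b \<noteq> [] \<longrightarrow> even x \<noteq> even (hd b)) \<and> parity_alternating b"
proof -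
  have "(\<forall>i. i < length b \<longrightarrow> even ((x # b) ! i) \<noteq> even (b ! i)) \<longleftrightarrow>
      (0 < length b \<longrightarrow> even x \<noteq> even (b ! 0)) \<and>
      (\<forall>i. Suc i < length b \<longrightarrow> even (b ! i) \<noteq> even (b ! Suc i))"
    by (metis nth_Cons_0 nth_Cons_Suc not0_implies_Suc)
  then show ?thesis
    by (cases "b = []") (simp_all add: parity_alternating_def hd_conv_nth)
qed

text \<open>Neighbouring signs cancel in pairs; in odd total length one sign survives, equal to that
  of the first letter.\<close>

lemma sum_list_sign_parity_alternating:
  assumes "parity_alternating (x # b)"
  shows "(\<Sum>y\<leftarrow>x # b. (-1 :: int) ^ y) = (if even (length b) then (-1) ^ x else 0)"
  using assms
proof (induction b arbitrary: x)
  case (Cons y b)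
  then have "parity_alternating (y # b)" "even x \<noteq> even y"
    by (simp_all add: parity_alternating_Cons)
  with Cons.IH[of y] show ?case
    by (cases "even x") auto
qed simp

lemma even_last_iff_even_hd:
  assumes "parity_alternating (x # b)"
  shows "even (last (x # b)) \<longleftrightarrow> (even x \<longleftrightarrow> even (length b))"
  using assms by (induction b arbitrary: x) (auto simp: parity_alternating_Cons)

lemma parity_alternating_append_single:
  assumes "xs \<noteq> []"
  shows "parity_alternating (xs @ [y]) \<longleftrightarrow>
    parity_alternating xs \<and> even (last xs) \<noteq> even y"
  using assms by (induction xs rule: list_nonempty_induct)
    (auto simp: parity_alternating_Cons parity_alternating_def[of "[]"])

text \<open>Moving the first letter to the end trades its adjacency with the second letter for one
  with the last. In an alternating word of even length these two neighbours have equal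
  parity.\<close>

lemma parity_alternating_rotate1:
  assumes "even (length xs)"
  shows "parity_alternating (rotate1 xs) \<longleftrightarrow> parity_alternating xs"
proof (cases xs)
  case (Cons x b)
  show ?thesis
  proof (cases b)
    case Nil
    then show ?thesis using Cons by simp
  next
    case (Cons y c)
    then show ?thesis
      using assms \<open>xs = x # b\<close> even_last_iff_even_hd[of y c]
      by (auto simp: parity_alternating_append_single parity_alternating_Cons[of x]
          simp flip: append_Cons)
  qed
qed simp

lemma parity_alternating_rotate:
  assumes "even (length xs)"
  shows "parity_alternating (rotate r xs) \<longleftrightarrow> parity_alternating xs"
  using assms by (induction r) (simp_all add: parity_alternating_rotate1)

text \<open>In \<open>{1..m}\<close> with \<open>m\<close> odd, odd numbers outnumber even ones; the signed sum detects this.\<close>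

lemma odd_hd_parity_alternating:
  assumes "b \<in> permutations_of_set {1..m}" "odd m" "parity_alternating b"
  shows "odd (hd b)"
proof -
  have b: "set b = {1..m}" "distinct b"
    using assms by (auto simp: permutations_of_set_def)
  have len: "length b = m" using b distinct_card[of b] by simp
  then obtain x c where x: "b = x # c" using \<open>odd m\<close> by (cases b) auto
  have "(\<Sum>y\<leftarrow>b. (-1 :: int) ^ y) = (\<Sum>y = 1..m. (-1) ^ y)"
    using b by (metis sum_list_distinct_conv_sum_set)
  also have "\<dots> = (if odd m then -1 else 0)"
    by (induction m) auto
  finally have "(-1 :: int) ^ x = -1"
    using sum_list_sign_parity_alternating[of x c] assms len x by auto
  then show ?thesis using x by (auto simp: minus_one_power_iff split: if_splits)
qed

text \<open>Even length makes the rotation harmless. Since \<open>n - 1\<close> is odd, an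
  alternating \<open>b\<close> begins with an odd letter, so the even letter \<open>n\<close> fits
  in front.\<close>

lemma parity_alternating_rotate_Cons:
  assumes "even n" "n > 0" "b \<in> permutations_of_set {1..n - 1}"
  shows "parity_alternating (rotate r (n # b)) \<longleftrightarrow> parity_alternating b"
proof -
  have "set b = {1..n - 1}" "distinct b"
    using assms by (auto simp: permutations_of_set_def)
  then have "length b = n - 1" using distinct_card[of b] by simp
  then have "even (length (n # b))" using assms by simp
  then have "parity_alternating (rotate r (n # b)) \<longleftrightarrow> parity_alternating (n # b)"
    by (rule parity_alternating_rotate)
  also have "\<dots> \<longleftrightarrow> parity_alternating b"
    using odd_hd_parity_alternating[OF assms(3)] assms by (auto simp: parity_alternating_Cons)
  finally show ?thesis .
qed

theorem theorem4:
  fixes n k :: nat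
  assumes "even n" and "n > 0" and "1 \<le> k" and "k \<le> n - 1"
  shows "pap_count n k = (n - k) * pap_count (n - 1) (k - 1) + (k + 1) * pap_count (n - 1) k \<and>
         non_pap_count n k =
           (n - k) * non_pap_count (n - 1) (k - 1) + (k + 1) * non_pap_count (n - 1) k"
proof -
  have n: "n \<ge> 2" using assms by linarith
  note rot = parity_alternating_rotate_Cons[OF assms(1,2)]
  show ?thesis
    unfolding pap_count_def non_pap_count_def
    by (intro conjI card_permutations_ascents_recurrence[OF n assms(3)]) (simp_all add: rot)
qed

end
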